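(* Let $\lambda\in\mathbb{R}$, let $z\in\mathbb{C}$ with $z\ne0$, and let $f_{\lambda}(t)=\sum_{k=0}^{\infty}a_{k}(t)_{k,\lambda}$ be a degenerate formal power series. Then $$\sum_{n=1}^{\infty}\frac{1}{n}\bigg\{\sum_{k=0}^{n}\binom{n}{k}(-1)^{k}f_{\lambda}(zk)\bigg\}=-z\sum_{m=1}^{\infty}a_{m}(-1)^{m-1}\lambda^{m-1}(m-1)!,$$ understood formally in the coefficients $a_m$, i.e. for each $m\ge 0$ the coefficients of $a_m$ on the two sides are equal.
   Context: The $\lambda$-falling factorials are $(x)_{0,\lambda}=1$ and $(x)_{n,\lambda}=x(x-\lambda)(x-2\lambda)\cdots(x-(n-1)\lambda)$ for $n\ge1$. Convention: $\lambda^0=1$, also for $\lambda=0$. A degenerate formal power series is an expression $f_{\lambda}(t)=\sum_{k=0}^{\infty}a_{k}(t)_{k,\lambda}$ with coefficients $a_0,a_1,a_2,\dots$; for a number $w$, $f_\lambda(w)$ denotes the formal sum $\sum_{m=0}^{\infty}a_m (w)_{m,\lambda}$. Each side of an identity is regarded as a formal linear combination $\sum_{m\ge0}a_m c_m$ with $c_m\in\mathbb{C}$; the outer sum over $n$ is carried out coefficientwise in the $a_m$ (for each $m$, the coefficient of $a_m$ in the inner braces vanishes for $n>m$, so only finitely many $n$ contribute). *)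

theory Defs
  imports Complex_Main
begin

definition lam_falling :: "real \<Rightarrow> complex \<Rightarrow> nat \<Rightarrow> complex" where
  "lam_falling lam x n = (\<Prod>j<n. x - of_nat j * of_real lam)"

text \<open>
  The coefficients of a degenerate formal power series are treated as indeterminates
  \<open>a\<^sub>0, a\<^sub>1, a\<^sub>2, \<dots>\<close>. A formal linear combination of them (infinitely many
  may occur) is given by its family of complex coefficients: \<open>c\<close> stands for
  \<open>c 0 a\<^sub>0 + c 1 a\<^sub>1 + c 2 a\<^sub>2 + \<dots>\<close>, so that equality means equality of the coefficients
  of every \<open>a\<^sub>m\<close>.
\<close>

type_synonym formal_comb = "nat \<Rightarrow> complex"

definition indet :: "nat \<Rightarrow> formal_comb" where
  "indet m = (\<lambda>i. if i = m then 1 else 0)"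

definition formal_scale :: "complex \<Rightarrow> formal_comb \<Rightarrow> formal_comb" where
  "formal_scale u c = (\<lambda>m. u * c m)"

text \<open>
  Sums are taken coefficientwise and without any limit process: a family is summable if every
  \<open>a\<^sub>m\<close> occurs in only finitely many of its members. The value of \<open>formal_sum\<close> is
  meaningful for summable families only.
\<close>

definition formal_summable :: "('i \<Rightarrow> formal_comb) \<Rightarrow> 'i set \<Rightarrow> bool" where
  "formal_summable F N \<longleftrightarrow> (\<forall>m. finite {n \<in> N. F n m \<noteq> 0})"

definition formal_sum :: "('i \<Rightarrow> formal_comb) \<Rightarrow> 'i set \<Rightarrow> formal_comb" where
  "formal_sum F N = (\<lambda>m. \<Sum>n\<in>{n \<in> N. F n m \<noteq> 0}. F n m)"

definition formal_has_sum :: "('i \<Rightarrow> formal_comb) \<Rightarrow> 'i set \<Rightarrow> formal_comb \<Rightarrow> bool" where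
  "formal_has_sum F N S \<longleftrightarrow> formal_summable F N \<and> formal_sum F N = S"

definition degenerate_series :: "real \<Rightarrow> (nat \<Rightarrow> formal_comb) \<Rightarrow> complex \<Rightarrow> formal_comb" where
  "degenerate_series lam a w = formal_sum (\<lambda>m. formal_scale (lam_falling lam w m) (a m)) UNIV"

lemma formal_summable_finite: "finite N \<Longrightarrow> formal_summable F N"
  by (simp add: formal_summable_def)

lemma formal_sum_finite: "finite N \<Longrightarrow> formal_sum F N m = (\<Sum>n\<in>N. F n m)"
  unfolding formal_sum_def by (rule sum.mono_neutral_left) auto

lemma formal_summable_indet: "formal_summable (\<lambda>m. formal_scale (c m) (indet m)) N"
  unfolding formal_summable_def
proof
  fix i
  have "{n \<in> N. formal_scale (c n) (indet n) i \<noteq> 0} \<subseteq> {i}"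
    by (auto simp: formal_scale_def indet_def)
  then show "finite {n \<in> N. formal_scale (c n) (indet n) i \<noteq> 0}"
    by (rule finite_subset) simp
qed

lemma formal_sum_indet:
  "formal_sum (\<lambda>m. formal_scale (c m) (indet m)) N i = (if i \<in> N then c i else 0)"
proof -
  have "{n \<in> N. formal_scale (c n) (indet n) i \<noteq> 0} = (if i \<in> N \<and> c i \<noteq> 0 then {i} else {})"
    by (auto simp: formal_scale_def indet_def)
  then show ?thesis
    by (auto simp: formal_sum_def formal_scale_def indet_def)
qed

lemma degenerate_series_coeff: "degenerate_series lam indet w m = lam_falling lam w m"
  by (simp add: degenerate_series_def formal_sum_indet)

end

theory Submission
  imports Defs
begin

text \<open>
  Write \<open>A\<^sub>n g = (\<Sum>k\<le>n. (n choose k) (-1)^k g k)\<close>, which is \<open>(-1)^n\<close> times the \<open>n\<close>-th forward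
  difference of \<open>g\<close> at \<open>0\<close>. The coefficient of \<open>a\<^sub>m\<close> in the braces is \<open>A\<^sub>n g\<close> for the polynomial
  \<open>g k = (z k)\<^sub>m\<^sub>,\<^sub>\<lambda>\<close> of degree at most \<open>m\<close>, so the claim is an instance of the operator identity
  \<open>log (1 + \<Delta>) = D\<close>: the sum of \<open>A\<^sub>n g / n\<close> over \<open>n \<ge> 1\<close> is \<open>- g' 0\<close>, and \<open>g' 0\<close> is the product of \<open>z\<close>
  with \<open>- j \<lambda>\<close> for \<open>0 < j < m\<close>.

  A single recursion proves this instance. From
  \<open>k (n choose k) = n ((n choose k) - (n - 1 choose k))\<close> one gets
  \<open>A\<^sub>n (k g) = n (A\<^sub>n g - A\<^sub>n\<^sub>-\<^sub>1 g)\<close> (lemma \<open>alt_binomial_sum_mult_index\<close>). It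
  shows that each linear factor of \<open>g\<close> raises by at most one the index from which on \<open>A\<^sub>n g\<close>
  vanishes (\<open>alt_binomial_sum_prod_linear_eq_0\<close>); and dividing it by \<open>n\<close> makes the sum of
  \<open>A\<^sub>n (k g) / n\<close> telescope to \<open>A\<^sub>N g - g 0\<close> (\<open>sum_alt_binomial_sum_mult_index\<close>). For \<open>m \<ge> 1\<close> the
  polynomial \<open>(z k)\<^sub>m\<^sub>,\<^sub>\<lambda>\<close> has the factor \<open>k\<close>, so both facts apply; for \<open>m = 0\<close> everything vanishes.
\<close>

definition alt_binomial_sum :: "(nat \<Rightarrow> 'a::comm_ring_1) \<Rightarrow> nat \<Rightarrow> 'a" where
  "alt_binomial_sum g n = (\<Sum>k\<le>n. of_nat (n choose k) * (-1) ^ k * g k)"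

lemma alt_binomial_sum_0 [simp]: "alt_binomial_sum g 0 = g 0"
  by (simp add: alt_binomial_sum_def)

lemma alt_binomial_sum_1: "n > 0 \<Longrightarrow> alt_binomial_sum (\<lambda>_. 1) n = 0"
  using choose_alternating_sum[of n]
  by (simp add: alt_binomial_sum_def mult.commute)

lemma alt_binomial_sum_diff:
  "alt_binomial_sum (\<lambda>k. f k - g k) n = alt_binomial_sum f n - alt_binomial_sum g n"
  by (simp add: alt_binomial_sum_def right_diff_distrib sum_subtractf)

lemma alt_binomial_sum_cmult:
  "alt_binomial_sum (\<lambda>k. c * g k) n = c * alt_binomial_sum g n"
  by (simp add: alt_binomial_sum_def sum_distrib_left ac_simps)

text \<open>
  Holds termwise, by the absorption identity \<open>k (n choose k) = n (n - 1 choose k - 1)\<close> and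
  Pascal's rule. The difference on the right is what makes the sum over \<open>n\<close> telescope.
\<close>

lemma alt_binomial_sum_mult_index:
  "alt_binomial_sum (\<lambda>k. of_nat k * g k) (Suc n)
    = of_nat (Suc n) * (alt_binomial_sum g (Suc n) - alt_binomial_sum g n)"
proof -
  have absorb: "of_nat k * of_nat (Suc n choose k)
      = (of_nat (Suc n) * (of_nat (Suc n choose k) - of_nat (n choose k)) :: 'a)" for k
  proof (cases k)
    case (Suc j)
    have "of_nat (Suc j * (Suc n choose Suc j)) = (of_nat (Suc n * (n choose j)) :: 'a)"
      by (simp only: Suc_times_binomial_eq mult.commute)
    then show ?thesis
      using Suc by (simp del: mult_Suc mult_Suc_right of_nat_Suc)
  qed simp
  \<comment> \<open>The added term is zero; it gives all three sums the same range.\<close>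
  have extend: "alt_binomial_sum g n = (\<Sum>k\<le>Suc n. of_nat (n choose k) * (-1) ^ k * g k)"
    by (simp add: alt_binomial_sum_def binomial_eq_0)
  have "alt_binomial_sum (\<lambda>k. of_nat k * g k) (Suc n)
      = (\<Sum>k\<le>Suc n. (of_nat k * of_nat (Suc n choose k)) * ((-1) ^ k * g k))"
    unfolding alt_binomial_sum_def by (intro sum.cong) (simp_all add: ac_simps)
  also have "\<dots> = of_nat (Suc n) * (\<Sum>k\<le>Suc n. of_nat (Suc n choose k) * (-1) ^ k * g k
      - of_nat (n choose k) * (-1) ^ k * g k)"
    unfolding absorb sum_distrib_left
    by (intro sum.cong) (simp_all only: left_diff_distrib right_diff_distrib mult.assoc)
  also have "\<dots> = of_nat (Suc n) * (alt_binomial_sum g (Suc n) - alt_binomial_sum g n)"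
    by (simp only: extend sum_subtractf) (simp only: alt_binomial_sum_def)
  finally show ?thesis .
qed

text \<open>
  Finite differences of order exceeding the degree vanish. Stating this for products of linear
  factors lets it apply to falling factorials by induction on the number of factors.
\<close>

lemma alt_binomial_sum_prod_linear_eq_0:
  assumes "m < n"
  shows "alt_binomial_sum (\<lambda>k. \<Prod>j<m. z * of_nat k - c j) n = 0"
  using assms
proof (induction m arbitrary: n)
  case 0
  then show ?case by (simp add: alt_binomial_sum_1)
next
  case (Suc m)
  let ?g = "\<lambda>k. \<Prod>j<m. z * of_nat k - c j"
  obtain n' where n: "n = Suc n'" and "m < n'"
    using Suc.prems by (cases n) auto
  have vanish: "alt_binomial_sum ?g n = 0" "alt_binomial_sum ?g n' = 0"
    using Suc.IH \<open>m < n'\<close> n by simp_all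
  have "(\<lambda>k. \<Prod>j<Suc m. z * of_nat k - c j)
      = (\<lambda>k. z * (of_nat k * ?g k) - c m * ?g k)"
    by (simp add: algebra_simps)
  then have "alt_binomial_sum (\<lambda>k. \<Prod>j<Suc m. z * of_nat k - c j) n
      = z * alt_binomial_sum (\<lambda>k. of_nat k * ?g k) n - c m * alt_binomial_sum ?g n"
    by (simp only: alt_binomial_sum_diff alt_binomial_sum_cmult)
  also have "\<dots> = 0"
    using vanish unfolding n alt_binomial_sum_mult_index by simp
  finally show ?case .
qed

text \<open>
  The truncated form of \<open>log (1 + \<Delta>) = D\<close>: the derivative of \<open>k g(k)\<close> at \<open>0\<close> is \<open>g 0\<close>, and
  \<open>alt_binomial_sum g N\<close> is the error, which is zero once \<open>N\<close> exceeds the degree of \<open>g\<close>.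
\<close>

lemma sum_alt_binomial_sum_mult_index:
  fixes g :: "nat \<Rightarrow> 'a::field_char_0"
  shows "(\<Sum>n=1..N. alt_binomial_sum (\<lambda>k. of_nat k * g k) n / of_nat n)
    = alt_binomial_sum g N - g 0"
proof (induction N)
  case (Suc N)
  have "alt_binomial_sum (\<lambda>k. of_nat k * g k) (Suc N) / of_nat (Suc N)
      = alt_binomial_sum g (Suc N) - alt_binomial_sum g N"
    unfolding alt_binomial_sum_mult_index
    by (simp del: of_nat_Suc)
  with Suc show ?case by simp
qed simp

lemma alt_binomial_sum_lam_falling_eq_0:
  "m < n \<Longrightarrow> alt_binomial_sum (\<lambda>k. lam_falling lam (z * of_nat k) m) n = 0"
  unfolding lam_falling_def by (rule alt_binomial_sum_prod_linear_eq_0)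

text \<open>
  Splitting off the factor \<open>z k\<close> of \<open>(z k)\<^sub>m\<^sub>,\<^sub>\<lambda>\<close> leaves \<open>m - 1\<close> linear factors, so the error term of
  the telescoped sum vanishes already at \<open>N = m\<close> and only the value of the cofactor at \<open>0\<close> remains.
\<close>

lemma sum_alt_binomial_sum_lam_falling:
  assumes "m \<ge> 1"
  shows "(\<Sum>n=1..m. alt_binomial_sum (\<lambda>k. lam_falling lam (z * of_nat k) m) n / of_nat n)
    = - z * ((-1) ^ (m - 1) * of_real lam ^ (m - 1) * fact (m - 1))"
proof -
  obtain q where m: "m = Suc q"
    using assms by (cases m) auto
  define g where "g k = z * (\<Prod>j<q. z * of_nat k - of_nat (Suc j) * of_real lam)" for k
  have "lam_falling lam (z * of_nat k) m = of_nat k * g k" for k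
    unfolding lam_falling_def m g_def prod.lessThan_Suc_shift by simp
  then have "(\<Sum>n=1..m. alt_binomial_sum (\<lambda>k. lam_falling lam (z * of_nat k) m) n / of_nat n)
      = alt_binomial_sum g m - g 0"
    by (simp only: sum_alt_binomial_sum_mult_index)
  also have "alt_binomial_sum g m = 0"
    unfolding g_def alt_binomial_sum_cmult
    by (simp only: alt_binomial_sum_prod_linear_eq_0 m lessI mult_zero_right)
  also have "g 0 = z * (\<Prod>j<q. (- of_real lam) * of_nat (Suc j))"
    by (simp add: g_def algebra_simps)
  also have "\<dots> = z * ((- of_real lam) ^ q * fact q)"
    by (simp only: prod.distrib prod_constant card_lessThan fact_prod_Suc of_nat_prod
        lessThan_atLeast0 card_atLeastLessThan diff_zero)
  also have "(- of_real lam :: complex) ^ q = (-1) ^ q * of_real lam ^ q"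
    by (rule power_minus)
  finally show ?thesis
    by (simp add: m)
qed

theorem theorem6:
  fixes lam :: real and z :: complex
  assumes "z \<noteq> 0"
  shows "formal_has_sum
    (\<lambda>n. formal_scale (1 / of_nat n)
      (formal_sum
        (\<lambda>k. formal_scale (of_nat (n choose k) * (-1) ^ k)
          (degenerate_series lam indet (z * of_nat k)))
        {0..n}))
    {1..}
    (formal_scale (- z)
      (formal_sum
        (\<lambda>m. formal_scale ((-1) ^ (m - 1) * of_real lam ^ (m - 1) * fact (m - 1)) (indet m))
        {1..}))"
proof -
  let ?A = "\<lambda>m. alt_binomial_sum (\<lambda>k. lam_falling lam (z * of_nat k) m)"
  let ?F = "\<lambda>n. formal_scale (1 / of_nat n)
      (formal_sum
        (\<lambda>k. formal_scale (of_nat (n choose k) * (-1) ^ k)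
          (degenerate_series lam indet (z * of_nat k)))
        {0..n})"
  have coeff: "?F n m = ?A m n / of_nat n" for n m
    by (simp add: formal_scale_def formal_sum_finite degenerate_series_coeff
        alt_binomial_sum_def atLeast0AtMost)
  have supp: "{n \<in> {1..}. ?F n m \<noteq> 0} \<subseteq> {1..m}" for m
  proof
    fix n
    assume "n \<in> {n \<in> {1..}. ?F n m \<noteq> 0}"
    then have "n \<ge> 1" "?A m n \<noteq> 0"
      by (simp_all add: coeff)
    then show "n \<in> {1..m}"
      using alt_binomial_sum_lam_falling_eq_0[of m n lam z] by (cases "m < n") simp_all
  qed
  have total: "formal_sum ?F {1..} m = (\<Sum>n=1..m. ?A m n / of_nat n)" for m
  proof -
    have "formal_sum ?F {1..} m = (\<Sum>n\<in>{n \<in> {1..}. ?F n m \<noteq> 0}. ?F n m)"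
      by (rule formal_sum_def[THEN fun_cong])
    also have "\<dots> = (\<Sum>n=1..m. ?F n m)"
      using supp by (intro sum.mono_neutral_left) auto
    finally show ?thesis
      by (simp only: coeff)
  qed
  show ?thesis
    unfolding formal_has_sum_def formal_summable_def
  proof (intro conjI allI ext)
    show "finite {n \<in> {1..}. ?F n m \<noteq> 0}" for m
      using supp by (rule finite_subset) simp
    show "formal_sum ?F {1..} m = formal_scale (- z)
        (formal_sum
          (\<lambda>m. formal_scale ((-1) ^ (m - 1) * of_real lam ^ (m - 1) * fact (m - 1)) (indet m))
          {1..}) m" for m
    proof (cases "m \<ge> 1")
      case True
      then show ?thesis
        unfolding total sum_alt_binomial_sum_lam_falling[OF True]
        by (simp add: formal_scale_def[of "- z"] formal_sum_indet)
    next
      case False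
      then show ?thesis
        unfolding total by (simp add: formal_scale_def[of "- z"] formal_sum_indet)
    qed
  qed
qed

end
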